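(* Assume $a\in C(\mathbb R,\mathbb R)$ fulfills the $c$-identity requirement for a number $c\ge 2$ with $I\in\mathcal N$. Then the parallelization $p_I:\bigcup_{n\in\mathbb N}\mathcal N^n\to\mathcal N$ satisfies $$\mathcal P(p_I(\phi_1,\dots,\phi_n))\le\Big(\tfrac{11}{16}c^2l^2n^2-1\Big)\sum_{j=1}^n\mathcal P(\phi_j)$$ for all $n\in\mathbb N$ and $\phi_1,\dots,\phi_n\in\mathcal N$, where $l=\max_{j\in\{1,\dots,n\}}\max\{l_0^{\phi_j},l_{\mathcal D(\phi_j)}^{\phi_j}\}$.
   Context: $\mathbb N=\{1,2,\dots\}$. A skeleton is $\phi=[(V_1,b_1),\dots,(V_D,b_D)]$ with $D\in\mathbb N$, $l_0,\dots,l_D\in\mathbb N$, $V_k\in\mathbb R^{l_k\times l_{k-1}}$, $b_k\in\mathbb R^{l_k}$. $\mathcal N$ is the set of all skeletons; $\mathcal D(\phi)=D$ (depth), $l_k^\phi=l_k$, $\mathcal P(\phi)=\sum_{k=1}^D l_k(l_{k-1}+1)$. For $a\in C(\mathbb R,\mathbb R)$ (applied componentwise), the $a$-realization is $\mathcal R_a^\phi=A_D\circ a\circ A_{D-1}\circ\cdots\circ a\circ A_1$ with $A_k(x)=V_kx+b_k$. $a$ fulfills the $c$-identity requirement ($c\ge2$) with $I\in\mathcal N$ if $\mathcal D(I)=2$, $l_1^I\le c$ and $\mathcal R_a^I=\mathrm{id}_{\mathbb R}$. Concatenation: for $\phi_1=[(V_1,b_1),\dots,(V_D,b_D)]$ and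 $\phi_2=[(W_1,c_1),\dots,(W_E,c_E)]$ with $l_D^{\phi_1}=l_0^{\phi_2}$, $\phi_2\circ\phi_1=[(V_1,b_1),\dots,(V_{D-1},b_{D-1}),(W_1V_D,W_1b_D+c_1),(W_2,c_2),\dots,(W_E,c_E)]$; this operation is associative and has depth $D+E-1$. Standard parallelization: for $\phi_1,\dots,\phi_n$ of the same depth, $p(\phi_1,\dots,\phi_n)$ is the skeleton of that depth whose $k$th weight matrix is block diagonal with the $k$th weight matrices of $\phi_1,\dots,\phi_n$ as diagonal blocks and whose $k$th bias vector is the concatenation of the $k$th bias vectors. For $d\in\mathbb N$ let $I_d=p(I,\dots,I)$ ($d$ copies). Diagonal parallelization $p_I$: given $\phi_1,\dots,\phi_n\in\mathcal N$ of arbitrary depths, for each $i$ let $\tilde\phi_i$ be obtained by concatenating $\sum_{j<i}\mathcal D(\phi_j)$ copies of $I_{l_0^{\phi_i}}$ in front of $\phi_i$ (on the input side) and $\sum_{j>i}\mathcal D(\phi_j)$ copies of $I_{l^{\phi_i}_{\mathcal D(\phi_i)}}$ after $\phi_i$ (on the output side). All $\tilde\phi_i$ have depth $\sum_{j=1}^n\mathcal D(\phi_j)$, and $p_I(\phi_1,\dots,\phi_n)=p(\tilde\phi_1,\dots,\tilde\phi_n)$. Its $a$-realization is $(x_1,\dots,x_n)\mapsto(\mathcal R_a^{\phi_1}(x_1),\dots,\mathcal R_a^{\phi_n}(x_n))$. *)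

theory Defs
  imports Complex_Main "Jordan_Normal_Form.Matrix"
begin

type_synonym skeleton = "(real mat \<times> real vec) list"

definition depth :: "skeleton \<Rightarrow> nat" where
  "depth \<phi> = length \<phi>"

(* width \<phi> k is l_k for 0 \<le> k \<le> depth \<phi>. Lists count from 0, so the pair (V_k, b_k)
   is \<phi> ! (k - 1). *)
definition width :: "skeleton \<Rightarrow> nat \<Rightarrow> nat" where
  "width \<phi> k = (if k = 0 then dim_col (fst (\<phi> ! 0)) else dim_row (fst (\<phi> ! (k - 1))))"

definition skeletons :: "skeleton set" where
  "skeletons = {\<phi>. depth \<phi> \<ge> 1 \<and> (\<forall>k\<in>{0..depth \<phi>}. width \<phi> k \<ge> 1) \<and>
     (\<forall>k\<in>{1..depth \<phi>}. fst (\<phi> ! (k - 1)) \<in> carrier_mat (width \<phi> k) (width \<phi> (k - 1)) \<and>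
                       snd (\<phi> ! (k - 1)) \<in> carrier_vec (width \<phi> k))}"

definition num_params :: "skeleton \<Rightarrow> nat" where
  "num_params \<phi> = (\<Sum>k=1..depth \<phi>. width \<phi> k * (width \<phi> (k - 1) + 1))"

(* The empty list is not a skeleton; its equation only makes the function total. *)
fun realization :: "(real \<Rightarrow> real) \<Rightarrow> skeleton \<Rightarrow> real vec \<Rightarrow> real vec" where
  "realization a [] x = x"
| "realization a [(V, b)] x = V *\<^sub>v x + b"
| "realization a ((V, b) # A # \<phi>) x = realization a (A # \<phi>) (map_vec a (V *\<^sub>v x + b))"

(* The real line is identified with the vectors of dimension 1; that the realization is the
   identity of the real line includes that the input and output widths are 1. *)
definition identity_requirement :: "(real \<Rightarrow> real) \<Rightarrow> real \<Rightarrow> skeleton \<Rightarrow> bool" where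
  "identity_requirement a c I \<longleftrightarrow>
     I \<in> skeletons \<and> depth I = 2 \<and> real (width I 1) \<le> c \<and>
     width I 0 = 1 \<and> width I (depth I) = 1 \<and> (\<forall>x\<in>carrier_vec 1. realization a I x = x)"

(* concatenate \<phi>\<^sub>2 \<phi>\<^sub>1 feeds the output of \<phi>\<^sub>1 into \<phi>\<^sub>2; it is meaningful only
   if the output width of \<phi>\<^sub>1 is the input width of \<phi>\<^sub>2. *)
definition concatenate :: "skeleton \<Rightarrow> skeleton \<Rightarrow> skeleton" where
  "concatenate \<phi>\<^sub>2 \<phi>\<^sub>1 =
     butlast \<phi>\<^sub>1 @
     (fst (hd \<phi>\<^sub>2) * fst (last \<phi>\<^sub>1), fst (hd \<phi>\<^sub>2) *\<^sub>v snd (last \<phi>\<^sub>1) + snd (hd \<phi>\<^sub>2)) # tl \<phi>\<^sub>2"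

(* Meaningful only for a nonempty list of skeletons of the same depth. *)
definition parallelize :: "skeleton list \<Rightarrow> skeleton" where
  "parallelize \<phi>s =
     map (\<lambda>k. (diag_block_mat (map (\<lambda>\<phi>. fst (\<phi> ! k)) \<phi>s),
               foldr (@\<^sub>v) (map (\<lambda>\<phi>. snd (\<phi> ! k)) \<phi>s) vNil))
       [0..<depth (hd \<phi>s)]"

definition copies :: "skeleton \<Rightarrow> nat \<Rightarrow> skeleton" where
  "copies I d = parallelize (replicate d I)"

definition extend :: "skeleton \<Rightarrow> skeleton list \<Rightarrow> nat \<Rightarrow> skeleton" where
  "extend I \<phi>s i =
     (let \<phi> = \<phi>s ! i;
          before = (\<Sum>j<i. depth (\<phi>s ! j));
          after = (\<Sum>j\<in>{i<..<length \<phi>s}. depth (\<phi>s ! j))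
      in ((\<lambda>\<psi>. concatenate (copies I (width \<phi> (depth \<phi>))) \<psi>) ^^ after)
           (((\<lambda>\<psi>. concatenate \<psi> (copies I (width \<phi> 0))) ^^ before) \<phi>))"

definition diag_parallelize :: "skeleton \<Rightarrow> skeleton list \<Rightarrow> skeleton" where
  "diag_parallelize I \<phi>s = parallelize (map (extend I \<phi>s) [0..<length \<phi>s])"

end

theory Submission
  imports Defs
begin

text \<open>Let \<open>m\<close> be the inner width of \<open>I\<close>. The padded version of \<open>\<phi>\<^sub>i\<close> has at level \<open>k\<close> at most
\<open>m\<close> times the width of \<open>\<phi>\<^sub>i\<close> at level \<open>k - \<Sum>j<i. \<D>(\<phi>\<^sub>j)\<close>, clamped to the levels of \<open>\<phi>\<^sub>i\<close>. Split the
levels of the parallelization into \<open>n\<close> consecutive blocks, the \<open>i\<close>-th of length \<open>\<D>(\<phi>\<^sub>i)\<close>. Within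
block \<open>i\<close> all skeletons but \<open>\<phi>\<^sub>i\<close> are in their padded part, so a layer of \<open>\<phi>\<^sub>i\<close> with widths \<open>v\<close>, \<open>u\<close>
becomes a layer with at most \<open>(c u + M) (c v + M + 1)\<close> parameters, where \<open>M = c l (n - 1)\<close>. For
\<open>n \<ge> 2\<close> we have \<open>c \<le> M\<close>, and hence this is at most \<open>N (N + 1) / 2\<close> times \<open>u (v + 1)\<close>, where
\<open>N = c l n \<ge> 4\<close>; the constant \<open>11/16\<close> is what makes \<open>N (N + 1) / 2 \<le> 11/16 N\<^sup>2 - 1\<close> sharp at
\<open>N = 4\<close>.\<close>

section \<open>Layers and widths of concatenations\<close>

lemma width_0: "width \<phi> 0 = dim_col (fst (\<phi> ! 0))"
  by (simp add: width_def)

lemma width_Suc: "width \<phi> (Suc k) = dim_row (fst (\<phi> ! k))"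
  by (simp add: width_def)

text \<open>Working form with layers counted from 0. The row condition disappears because
  \<open>width\<close> at a positive level is itself a number of rows.\<close>

lemma skeletons_iff:
  "\<phi> \<in> skeletons \<longleftrightarrow> depth \<phi> \<ge> 1 \<and> (\<forall>k\<le>depth \<phi>. width \<phi> k \<ge> 1) \<and>
    (\<forall>k<depth \<phi>. dim_col (fst (\<phi> ! k)) = width \<phi> k \<and> dim_vec (snd (\<phi> ! k)) = width \<phi> (Suc k))"
proof -
  have levels: "(\<forall>k\<in>{1..d}. P k) \<longleftrightarrow> (\<forall>k<d. P (Suc k))" for P and d :: nat
    unfolding image_Suc_lessThan[symmetric] by auto
  have layer: "fst (\<phi> ! k) \<in> carrier_mat (width \<phi> (Suc k)) (width \<phi> k) \<and>
      snd (\<phi> ! k) \<in> carrier_vec (width \<phi> (Suc k)) \<longleftrightarrow>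
    dim_col (fst (\<phi> ! k)) = width \<phi> k \<and> dim_vec (snd (\<phi> ! k)) = width \<phi> (Suc k)" for k
    unfolding carrier_mat_def carrier_vec_def mem_Collect_eq width_Suc by blast
  have "(\<forall>k\<in>{0..depth \<phi>}. width \<phi> k \<ge> 1) \<longleftrightarrow> (\<forall>k\<le>depth \<phi>. width \<phi> k \<ge> 1)"
    by auto
  then show ?thesis
    unfolding skeletons_def mem_Collect_eq levels diff_Suc_1 layer by (rule arg_cong)
qed

lemma depth_concatenate:
  assumes "depth \<phi>\<^sub>1 \<ge> 1" and "depth \<phi>\<^sub>2 \<ge> 1"
  shows "depth (concatenate \<phi>\<^sub>2 \<phi>\<^sub>1) = depth \<phi>\<^sub>1 + depth \<phi>\<^sub>2 - 1"
  using assms by (simp add: depth_def concatenate_def)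

lemma nth_concatenate:
  assumes "depth \<phi>\<^sub>1 \<ge> 1" and "depth \<phi>\<^sub>2 \<ge> 1" and "k < depth \<phi>\<^sub>1 + depth \<phi>\<^sub>2 - 1"
  shows "concatenate \<phi>\<^sub>2 \<phi>\<^sub>1 ! k =
    (if k < depth \<phi>\<^sub>1 - 1 then \<phi>\<^sub>1 ! k
     else if k = depth \<phi>\<^sub>1 - 1 then
       (fst (\<phi>\<^sub>2 ! 0) * fst (\<phi>\<^sub>1 ! k), fst (\<phi>\<^sub>2 ! 0) *\<^sub>v snd (\<phi>\<^sub>1 ! k) + snd (\<phi>\<^sub>2 ! 0))
     else \<phi>\<^sub>2 ! (k - (depth \<phi>\<^sub>1 - 1)))"
proof -
  have ne: "\<phi>\<^sub>1 \<noteq> []" "\<phi>\<^sub>2 \<noteq> []"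
    using assms by (auto simp: depth_def)
  have "Suc (k - length \<phi>\<^sub>1) = Suc k - length \<phi>\<^sub>1" if "\<not> Suc k \<le> length \<phi>\<^sub>1"
    using that by linarith
  then show ?thesis
    using assms ne
    by (auto simp: concatenate_def depth_def nth_append nth_butlast last_conv_nth hd_conv_nth
        nth_Cons' nth_tl)
qed

text \<open>The merged layer runs from the last hidden (or input) level of
  \<open>\<phi>\<^sub>1\<close> to level 1 of \<open>\<phi>\<^sub>2\<close>. So the output level of
  \<open>\<phi>\<^sub>1\<close> and level 0 of \<open>\<phi>\<^sub>2\<close> vanish, and level
  \<open>depth \<phi>\<^sub>1\<close> of the result is level 1 of
  \<open>\<phi>\<^sub>2\<close>.\<close>

lemma width_concatenate:
  assumes "depth \<phi>\<^sub>1 \<ge> 1" and "depth \<phi>\<^sub>2 \<ge> 1" and "k \<le> depth \<phi>\<^sub>1 + depth \<phi>\<^sub>2 - 1"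
  shows "width (concatenate \<phi>\<^sub>2 \<phi>\<^sub>1) k =
    (if k < depth \<phi>\<^sub>1 then width \<phi>\<^sub>1 k else width \<phi>\<^sub>2 (Suc k - depth \<phi>\<^sub>1))"
proof (cases k)
  case 0
  then show ?thesis
    using assms by (auto simp: width_0 nth_concatenate)
next
  case (Suc k')
  with assms(3) have "k' < depth \<phi>\<^sub>1 + depth \<phi>\<^sub>2 - 1"
    by simp
  moreover have "Suc (Suc k') - depth \<phi>\<^sub>1 = Suc (k' - (depth \<phi>\<^sub>1 - 1))" if "\<not> Suc k' < depth \<phi>\<^sub>1"
    using assms(1) that by linarith
  ultimately show ?thesis
    using assms(1,2) Suc by (auto simp: width_Suc nth_concatenate)
qed

lemma concatenate_in_skeletons:
  assumes "\<phi>\<^sub>1 \<in> skeletons" and "\<phi>\<^sub>2 \<in> skeletons" and "width \<phi>\<^sub>1 (depth \<phi>\<^sub>1) = width \<phi>\<^sub>2 0"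
  shows "concatenate \<phi>\<^sub>2 \<phi>\<^sub>1 \<in> skeletons"
proof -
  have d: "depth \<phi>\<^sub>1 \<ge> 1" "depth \<phi>\<^sub>2 \<ge> 1"
    using assms by (auto simp: skeletons_iff)
  have w1: "width \<phi>\<^sub>1 k \<ge> 1" if "k \<le> depth \<phi>\<^sub>1" for k
    using assms that by (auto simp: skeletons_iff)
  have w2: "width \<phi>\<^sub>2 k \<ge> 1" if "k \<le> depth \<phi>\<^sub>2" for k
    using assms that by (auto simp: skeletons_iff)
  have s1: "dim_col (fst (\<phi>\<^sub>1 ! k)) = width \<phi>\<^sub>1 k" "dim_vec (snd (\<phi>\<^sub>1 ! k)) = width \<phi>\<^sub>1 (Suc k)"
    if "k < depth \<phi>\<^sub>1" for k
    using assms that by (auto simp: skeletons_iff)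
  have s2: "dim_col (fst (\<phi>\<^sub>2 ! k)) = width \<phi>\<^sub>2 k" "dim_vec (snd (\<phi>\<^sub>2 ! k)) = width \<phi>\<^sub>2 (Suc k)"
    if "k < depth \<phi>\<^sub>2" for k
    using assms that by (auto simp: skeletons_iff)
  let ?\<psi> = "concatenate \<phi>\<^sub>2 \<phi>\<^sub>1"
  have "width ?\<psi> k \<ge> 1" if "k \<le> depth ?\<psi>" for k
  proof (cases "k < depth \<phi>\<^sub>1")
    case True
    then show ?thesis
      using that d w1[of k] by (simp add: depth_concatenate width_concatenate)
  next
    case False
    then show ?thesis
      using that d w2[of "Suc k - depth \<phi>\<^sub>1"] by (simp add: depth_concatenate width_concatenate)
  qed
  moreover have "dim_col (fst (?\<psi> ! k)) = width ?\<psi> k \<and> dim_vec (snd (?\<psi> ! k)) = width ?\<psi> (Suc k)"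
    if "k < depth ?\<psi>" for k
  proof -
    have k: "k < depth \<phi>\<^sub>1 + depth \<phi>\<^sub>2 - 1"
      using that d by (simp add: depth_concatenate)
    consider "Suc k < depth \<phi>\<^sub>1" | "Suc k = depth \<phi>\<^sub>1" | "depth \<phi>\<^sub>1 < Suc k"
      by linarith
    then show ?thesis
    proof cases
      case 1
      then show ?thesis
        using k d s1[of k] by (auto simp: nth_concatenate width_concatenate)
    next
      \<comment> \<open>The merged layer takes its columns from \<open>\<phi>\<^sub>1\<close>, its
        rows and the length of its bias from \<open>\<phi>\<^sub>2\<close>.\<close>
      case 2
      then have "k = depth \<phi>\<^sub>1 - 1" "k < depth \<phi>\<^sub>1" "Suc (Suc k) - depth \<phi>\<^sub>1 = Suc 0"
        by auto
      then show ?thesis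
        using k d s1[of k] s2[of 0] 2 by (simp add: nth_concatenate width_concatenate)
    next
      case 3
      then have "k - (depth \<phi>\<^sub>1 - 1) = Suc k - depth \<phi>\<^sub>1"
        "Suc (Suc k) - depth \<phi>\<^sub>1 = Suc (Suc k - depth \<phi>\<^sub>1)" "Suc k - depth \<phi>\<^sub>1 < depth \<phi>\<^sub>2"
        using k d by auto
      then show ?thesis
        using k d s2[of "Suc k - depth \<phi>\<^sub>1"] 3 by (auto simp: nth_concatenate width_concatenate)
    qed
  qed
  ultimately show ?thesis
    using d by (auto simp: skeletons_iff depth_concatenate)
qed

section \<open>Parallelizations and copies of the identity skeleton\<close>

lemma depth_parallelize: "depth (parallelize \<phi>s) = depth (hd \<phi>s)"
  by (simp add: parallelize_def depth_def)

lemma width_parallelize: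
  assumes "depth (hd \<phi>s) \<ge> 1" and "k \<le> depth (hd \<phi>s)"
  shows "width (parallelize \<phi>s) k = (\<Sum>\<phi>\<leftarrow>\<phi>s. width \<phi> k)"
  using assms by (cases k) (auto simp: parallelize_def width_def dim_diag_block_mat o_def)

lemma dim_vec_foldr_append:
  "dim_vec (foldr (@\<^sub>v) (map f xs) vNil) = (\<Sum>x\<leftarrow>xs. dim_vec (f x))"
  by (induction xs) auto

text \<open>Equal depth makes each layer index valid in all the skeletons at once, so dimensions add
  up layer by layer; one member already makes the widths positive.\<close>

lemma parallelize_in_skeletons:
  assumes "\<phi>s \<noteq> []" and sk: "\<And>\<phi>. \<phi> \<in> set \<phi>s \<Longrightarrow> \<phi> \<in> skeletons"
    and dp: "\<And>\<phi>. \<phi> \<in> set \<phi>s \<Longrightarrow> depth \<phi> = d"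
  shows "parallelize \<phi>s \<in> skeletons"
proof -
  have hd: "hd \<phi>s \<in> set \<phi>s" and dhd: "depth (hd \<phi>s) = d"
    using assms by auto
  have d: "d \<ge> 1"
    using sk[OF hd] dhd by (auto simp: skeletons_iff)
  have "width (parallelize \<phi>s) k \<ge> 1" if "k \<le> d" for k
  proof -
    have "1 \<le> width (hd \<phi>s) k"
      using sk[OF hd] dhd that by (auto simp: skeletons_iff)
    also have "\<dots> \<le> (\<Sum>\<phi>\<leftarrow>\<phi>s. width \<phi> k)"
      using hd by (intro member_le_sum_list) auto
    finally show ?thesis
      using d dhd that by (simp add: width_parallelize)
  qed
  moreover have "dim_col (fst (parallelize \<phi>s ! k)) = width (parallelize \<phi>s) k \<and>
      dim_vec (snd (parallelize \<phi>s ! k)) = width (parallelize \<phi>s) (Suc k)" if "k < d" for k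
  proof -
    have "(\<Sum>\<phi>\<leftarrow>\<phi>s. dim_col (fst (\<phi> ! k))) = (\<Sum>\<phi>\<leftarrow>\<phi>s. width \<phi> k)"
      "(\<Sum>\<phi>\<leftarrow>\<phi>s. dim_vec (snd (\<phi> ! k))) = (\<Sum>\<phi>\<leftarrow>\<phi>s. width \<phi> (Suc k))"
      using sk dp that by (auto simp: skeletons_iff intro!: arg_cong[of _ _ sum_list])
    moreover have "parallelize \<phi>s ! k =
      (diag_block_mat (map (\<lambda>\<phi>. fst (\<phi> ! k)) \<phi>s), foldr (@\<^sub>v) (map (\<lambda>\<phi>. snd (\<phi> ! k)) \<phi>s) vNil)"
      using that dhd by (simp add: parallelize_def)
    ultimately show ?thesis
      using that d dhd
      by (simp add: width_parallelize dim_diag_block_mat dim_vec_foldr_append o_def)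
  qed
  ultimately show ?thesis
    using d dhd by (auto simp: skeletons_iff depth_parallelize)
qed

lemma copies_in_skeletons: "I \<in> skeletons \<Longrightarrow> d \<ge> 1 \<Longrightarrow> copies I d \<in> skeletons"
  unfolding copies_def by (intro parallelize_in_skeletons[where d = "depth I"]) auto

lemma depth_copies: "d \<ge> 1 \<Longrightarrow> depth (copies I d) = depth I"
  by (cases d) (auto simp: copies_def depth_parallelize)

lemma width_copies:
  assumes "d \<ge> 1" and "depth I \<ge> 1" and "k \<le> depth I"
  shows "width (copies I d) k = d * width I k"
proof -
  have "hd (replicate d I) = I"
    using assms by (cases d) auto
  then show ?thesis
    using assms by (simp add: copies_def width_parallelize sum_list_replicate)
qed

section \<open>Widths after padding with identities\<close>

text \<open>Each further copy replaces level 0 by a level of width \<open>width \<phi> 0\<close>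
  followed by one wider by the factor \<open>width I 1\<close>, and shifts the rest by one.
  Truncated subtraction sends the padded levels to level 0 of \<open>\<phi>\<close>; allowing the
  factor everywhere gives one formula for all levels.\<close>

lemma prepend_identities:
  assumes I: "I \<in> skeletons" "depth I = 2" "width I 0 = 1" "width I 2 = 1"
    and \<phi>: "\<phi> \<in> skeletons"
  defines "\<psi> \<equiv> \<lambda>b. ((\<lambda>\<psi>. concatenate \<psi> (copies I (width \<phi> 0))) ^^ b) \<phi>"
  shows "\<psi> b \<in> skeletons \<and> depth (\<psi> b) = depth \<phi> + b \<and> width (\<psi> b) 0 = width \<phi> 0 \<and>
    width (\<psi> b) (depth (\<psi> b)) = width \<phi> (depth \<phi>) \<and>
    (\<forall>k\<le>depth (\<psi> b). width (\<psi> b) k \<le> width I 1 * width \<phi> (k - b))"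
proof -
  have m: "width I 1 \<ge> 1" and d: "width \<phi> 0 \<ge> 1" and D: "depth \<phi> \<ge> 1"
    using I \<phi> by (auto simp: skeletons_iff)
  let ?J = "copies I (width \<phi> 0)"
  have J: "?J \<in> skeletons" "depth ?J = 2" "width ?J 0 = width \<phi> 0"
    "width ?J (Suc 0) = width \<phi> 0 * width I 1" "width ?J 2 = width \<phi> 0"
    using I d by (auto simp: copies_in_skeletons depth_copies width_copies)
  show ?thesis
  proof (induction b)
    case 0
    then show ?case
      using \<phi> m by (auto simp: \<psi>_def)
  next
    case (Suc b)
    have eq: "\<psi> (Suc b) = concatenate (\<psi> b) ?J"
      by (simp add: \<psi>_def)
    have sk: "\<psi> b \<in> skeletons" and db: "depth (\<psi> b) = depth \<phi> + b"
      and w0: "width (\<psi> b) 0 = width \<phi> 0"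
      and wD: "width (\<psi> b) (depth \<phi> + b) = width \<phi> (depth \<phi>)"
      and le: "\<And>k. k \<le> depth \<phi> + b \<Longrightarrow> width (\<psi> b) k \<le> width I 1 * width \<phi> (k - b)"
      using Suc.IH by auto
    have dS: "depth (\<psi> (Suc b)) = depth \<phi> + Suc b"
      unfolding eq using J db D by (simp add: depth_concatenate)
    have w: "width (\<psi> (Suc b)) k = (if k < 2 then width ?J k else width (\<psi> b) (k - 1))"
      if "k \<le> depth \<phi> + Suc b" for k
      unfolding eq using J db D that by (simp add: width_concatenate numeral_2_eq_2)
    have "width (\<psi> (Suc b)) k \<le> width I 1 * width \<phi> (k - Suc b)" if k: "k \<le> depth \<phi> + Suc b" for k
    proof -
      consider "k = 0" | "k = Suc 0" | "k \<ge> 2" by linarith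
      then show ?thesis
      proof cases
        \<comment> \<open>The index shift by one agrees with the bound:
          \<open>k - 1 - b = k - Suc b\<close>.\<close>
        case 3
        then show ?thesis using w[OF k] le[of "k - 1"] k by simp
      qed (use w[OF k] J m in auto)
    qed
    moreover have "\<psi> (Suc b) \<in> skeletons"
      unfolding eq using J sk w0 by (intro concatenate_in_skeletons) auto
    ultimately show ?case
      using dS w[of 0] w[of "depth \<phi> + Suc b"] wD J D by auto
  qed
qed

text \<open>To be applied to a skeleton that is already padded in front. The levels below
  \<open>depth \<psi>\<close> are bounded without a new factor, so \<open>width I 1\<close> is not
  incurred twice.\<close>

lemma append_identities:
  assumes I: "I \<in> skeletons" "depth I = 2" "width I 0 = 1" "width I 2 = 1"
    and \<psi>: "\<psi> \<in> skeletons" "width \<psi> (depth \<psi>) = d"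
  defines "\<chi> \<equiv> \<lambda>e. ((\<lambda>\<psi>. concatenate (copies I d) \<psi>) ^^ e) \<psi>"
  shows "\<chi> e \<in> skeletons \<and> depth (\<chi> e) = depth \<psi> + e \<and>
    width (\<chi> e) (depth (\<chi> e)) = d \<and>
    (\<forall>k\<le>depth (\<chi> e). width (\<chi> e) k \<le> (if k < depth \<psi> then width \<psi> k else width I 1 * d))"
proof -
  have m: "width I 1 \<ge> 1" and d: "d \<ge> 1" and D: "depth \<psi> \<ge> 1"
    using I \<psi> by (auto simp: skeletons_iff)
  let ?J = "copies I d"
  have J: "?J \<in> skeletons" "depth ?J = 2" "width ?J 0 = d"
    "width ?J (Suc 0) = d * width I 1" "width ?J 2 = d"
    using I d by (auto simp: copies_in_skeletons depth_copies width_copies)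
  show ?thesis
  proof (induction e)
    case 0
    then show ?case
      using \<psi> m by (auto simp: \<chi>_def)
  next
    case (Suc e)
    have eq: "\<chi> (Suc e) = concatenate ?J (\<chi> e)"
      by (simp add: \<chi>_def)
    have sk: "\<chi> e \<in> skeletons" and de: "depth (\<chi> e) = depth \<psi> + e"
      and wD: "width (\<chi> e) (depth \<psi> + e) = d"
      and le: "\<And>k. k \<le> depth \<psi> + e \<Longrightarrow>
        width (\<chi> e) k \<le> (if k < depth \<psi> then width \<psi> k else width I 1 * d)"
      using Suc.IH by auto
    have dS: "depth (\<chi> (Suc e)) = depth \<psi> + Suc e"
      unfolding eq using J de D by (simp add: depth_concatenate)
    have w: "width (\<chi> (Suc e)) k =
        (if k < depth \<psi> + e then width (\<chi> e) k else width ?J (Suc k - (depth \<psi> + e)))"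
      if "k \<le> depth \<psi> + Suc e" for k
      unfolding eq using J de D that by (simp add: width_concatenate)
    have "width (\<chi> (Suc e)) k \<le> (if k < depth \<psi> then width \<psi> k else width I 1 * d)"
      if k: "k \<le> depth \<psi> + Suc e" for k
    proof -
      consider "k < depth \<psi> + e" | "k = depth \<psi> + e" | "k = depth \<psi> + Suc e"
        using k by linarith
      then show ?thesis
      proof cases
        case 1
        then show ?thesis using w[OF k] le[of k] by simp
      next
        case 3
        then have "Suc k - (depth \<psi> + e) = 2" by simp
        then show ?thesis using w[OF k] J m 3 by simp
      qed (use w[OF k] J in auto)
    qed
    moreover have "\<chi> (Suc e) \<in> skeletons"
      unfolding eq using J sk wD de by (intro concatenate_in_skeletons) auto
    moreover have "Suc (depth \<psi> + Suc e) - (depth \<psi> + e) = 2"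
      by simp
    ultimately show ?case
      using dS w[of "depth \<psi> + Suc e"] J by auto
  qed
qed

text \<open>The clamping to the levels of the original skeleton comes from both sides: truncated
  subtraction handles the identities in front, \<open>min\<close> those behind.\<close>

lemma extend_properties:
  assumes I: "I \<in> skeletons" "depth I = 2" "width I 0 = 1" "width I 2 = 1"
    and i: "i < length \<phi>s" and \<phi>: "\<phi>s ! i \<in> skeletons"
  shows "extend I \<phi>s i \<in> skeletons"
    and "depth (extend I \<phi>s i) = (\<Sum>j<length \<phi>s. depth (\<phi>s ! j))"
    and "k \<le> depth (extend I \<phi>s i) \<Longrightarrow> width (extend I \<phi>s i) k
      \<le> width I 1 * width (\<phi>s ! i) (min (k - (\<Sum>j<i. depth (\<phi>s ! j))) (depth (\<phi>s ! i)))"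
proof -
  let ?\<phi> = "\<phi>s ! i"
  define b where "b = (\<Sum>j<i. depth (\<phi>s ! j))"
  define e where "e = (\<Sum>j\<in>{i<..<length \<phi>s}. depth (\<phi>s ! j))"
  define \<psi> where "\<psi> = ((\<lambda>\<psi>. concatenate \<psi> (copies I (width ?\<phi> 0))) ^^ b) ?\<phi>"
  have \<psi>: "\<psi> \<in> skeletons" "depth \<psi> = depth ?\<phi> + b" "width \<psi> (depth \<psi>) = width ?\<phi> (depth ?\<phi>)"
    "\<And>k. k \<le> depth \<psi> \<Longrightarrow> width \<psi> k \<le> width I 1 * width ?\<phi> (k - b)"
    using prepend_identities[OF I \<phi>, of b] unfolding \<psi>_def by auto
  have ext: "extend I \<phi>s i = ((\<lambda>\<psi>. concatenate (copies I (width ?\<phi> (depth ?\<phi>))) \<psi>) ^^ e) \<psi>"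
    by (simp add: extend_def b_def e_def \<psi>_def Let_def)
  note \<chi> = append_identities[OF I \<psi>(1,3), of e, folded ext]
  show "extend I \<phi>s i \<in> skeletons"
    using \<chi> by blast
  \<comment> \<open>The total depth is the padding in front, the own depth and the padding
    behind.\<close>
  have "{..<length \<phi>s} = insert i ({..<i} \<union> {i<..<length \<phi>s})"
    using i by auto
  moreover have "sum f ({..<i} \<union> {i<..<length \<phi>s}) = sum f {..<i} + sum f {i<..<length \<phi>s}"
    for f :: "nat \<Rightarrow> nat"
    by (rule sum.union_disjoint) auto
  ultimately have "(\<Sum>j<length \<phi>s. depth (\<phi>s ! j)) = depth ?\<phi> + (b + e)"
    unfolding b_def e_def by simp
  then show "depth (extend I \<phi>s i) = (\<Sum>j<length \<phi>s. depth (\<phi>s ! j))"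
    using \<chi> \<psi>(2) by simp
  assume "k \<le> depth (extend I \<phi>s i)"
  then have le: "width (extend I \<phi>s i) k
      \<le> (if k < depth \<psi> then width \<psi> k else width I 1 * width ?\<phi> (depth ?\<phi>))"
    using \<chi> by blast
  show "width (extend I \<phi>s i) k \<le>
      width I 1 * width ?\<phi> (min (k - (\<Sum>j<i. depth (\<phi>s ! j))) (depth ?\<phi>))"
  proof (cases "k < depth \<psi>")
    case True
    then have "min (k - b) (depth ?\<phi>) = k - b"
      using \<psi>(2) by linarith
    then show ?thesis
      using le \<psi>(4)[of k] True by (simp add: b_def)
  next
    case False
    then have "min (k - b) (depth ?\<phi>) = depth ?\<phi>"
      using \<psi>(2) by linarith
    then show ?thesis
      using le False by (simp add: b_def)
  qed
qed

section \<open>Summation by blocks and the numerical estimate\<close>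

lemma sum_blocks:
  fixes f :: "nat \<Rightarrow> 'a::comm_monoid_add" and n :: nat
  shows "(\<Sum>k=1..(\<Sum>j<n. D j). f k) = (\<Sum>i<n. \<Sum>r=1..D i. f ((\<Sum>j<i. D j) + r))"
proof (induction n)
  case (Suc n)
  let ?S = "\<Sum>j<n. D j"
  have "(\<Sum>k=1..?S + D n. f k) = (\<Sum>k=1..?S. f k) + (\<Sum>k=Suc ?S..?S + D n. f k)"
    using sum.ub_add_nat[of 1 ?S f "D n"] by simp
  also have "(\<Sum>k=Suc ?S..?S + D n. f k) = (\<Sum>r=1..D n. f (?S + r))"
    using sum.shift_bounds_cl_nat_ivl[of f 1 ?S "D n"] by (simp add: add.commute)
  finally show ?case
    using Suc.IH by simp
qed simp

text \<open>The two factors are estimated separately, by \<open>u * N\<close> and by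
  \<open>(v + 1) * (N + 1) / 2\<close>. The gain of one half in the second rests on
  \<open>v + 1 \<ge> 2\<close>.\<close>

lemma layer_bound:
  fixes c L n u v :: real
  assumes "c \<ge> 2" and "L \<ge> 1" and "n \<ge> 2" and u: "u \<ge> 1" and v: "v \<ge> 1"
  shows "(c * u + c * L * (n - 1)) * (c * v + c * L * (n - 1) + 1)
    \<le> (11 / 16 * c\<^sup>2 * L\<^sup>2 * n\<^sup>2 - 1) * (u * (v + 1))"
proof -
  define M where "M = c * L * (n - 1)"
  define N where "N = c * L * n"
  have cL: "c \<le> c * L"
    using assms by simp
  moreover have "c * L * 1 \<le> M"
    unfolding M_def using assms by (intro mult_left_mono) auto
  ultimately have cM: "c \<le> M"
    by simp
  have MN: "c + M \<le> N"
    using cL by (simp add: M_def N_def algebra_simps)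
  \<comment> \<open>Both \<open>c\<close> and \<open>M\<close> are at least 2.\<close>
  have N: "N \<ge> 4"
    using MN cM assms(1) by linarith
  have "c * u + M \<le> u * (c + M)"
    using mult_right_mono[OF u, of M] cM assms(1) by (simp add: algebra_simps)
  also have "\<dots> \<le> u * N"
    using MN u by simp
  finally have 1: "c * u + M \<le> u * N" .
  \<comment> \<open>This product is twice the difference of the two sides of the next
    inequality.\<close>
  have "0 \<le> (v - 1) * (M + 1 - c)"
    using v cM by simp
  then have "c * v + M + 1 \<le> (v + 1) * (c + M + 1) / 2"
    by (simp add: algebra_simps)
  also have "\<dots> \<le> (v + 1) * (N + 1) / 2"
    using MN v by simp
  finally have 2: "c * v + M + 1 \<le> (v + 1) * (N + 1) / 2" .
  \<comment> \<open>This product is 16 times the difference of the two sides of the next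
    inequality.\<close>
  have "0 \<le> (N - 4) * (3 * N + 4)"
    using N by simp
  then have 3: "N * (N + 1) / 2 \<le> 11 / 16 * N\<^sup>2 - 1"
    by (simp add: field_simps power2_eq_square)
  have "(c * u + M) * (c * v + M + 1) \<le> (u * N) * ((v + 1) * (N + 1) / 2)"
    using 1 2 u v N cM assms(1) by (intro mult_mono) auto
  also have "\<dots> = N * (N + 1) / 2 * (u * (v + 1))"
    by simp
  also have "\<dots> \<le> (11 / 16 * N\<^sup>2 - 1) * (u * (v + 1))"
    using 3 u v by (intro mult_right_mono) auto
  finally show ?thesis
    by (simp add: M_def N_def power_mult_distrib mult.assoc)
qed

section \<open>The parameter count of the diagonal parallelization\<close>

theorem proposition5:
  fixes a :: "real \<Rightarrow> real" and c :: real and I :: skeleton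
    and \<phi>s :: "skeleton list" and n l :: nat
  assumes "continuous_on UNIV a"
    and "c \<ge> 2"
    and "identity_requirement a c I"
    and "n \<ge> 1"
    and "length \<phi>s = n"
    and "\<forall>j<n. \<phi>s ! j \<in> skeletons"
    and "l = Max ((\<lambda>j. max (width (\<phi>s ! j) 0) (width (\<phi>s ! j) (depth (\<phi>s ! j)))) ` {..<n})"
  shows "diag_parallelize I \<phi>s \<in> skeletons \<and>
    real (num_params (diag_parallelize I \<phi>s))
      \<le> (11 / 16 * c\<^sup>2 * (real l)\<^sup>2 * (real n)\<^sup>2 - 1) * (\<Sum>j<n. real (num_params (\<phi>s ! j)))"
proof -
  have I: "I \<in> skeletons" "depth I = 2" "width I 0 = 1" "width I 2 = 1"
    and mc: "real (width I 1) \<le> c"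
    using assms(3) by (auto simp: identity_requirement_def)
  define D where "D = (\<lambda>j. depth (\<phi>s ! j))"
  \<comment> \<open>Block \<open>i\<close> consists of the layers \<open>T i + 1\<close> to
    \<open>T i + D i\<close>, and \<open>T n\<close> is the total depth.\<close>
  define T where "T = (\<lambda>i. \<Sum>j<i. D j)"
  define w where "w = (\<lambda>k. \<Sum>j<n. width (extend I \<phi>s j) k)"
  let ?p = "diag_parallelize I \<phi>s"
  let ?K = "11 / 16 * c\<^sup>2 * (real l)\<^sup>2 * (real n)\<^sup>2 - 1"
  have sk: "\<phi>s ! j \<in> skeletons" if "j < n" for j
    using assms(6) that by blast
  have pos: "width (\<phi>s ! j) k \<ge> 1" if "j < n" "k \<le> D j" for j k
    using sk[OF that(1)] that(2) by (auto simp: skeletons_iff D_def)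
  have wl: "width (\<phi>s ! j) 0 \<le> l" "width (\<phi>s ! j) (D j) \<le> l" if "j < n" for j
  proof -
    have "max (width (\<phi>s ! j) 0) (width (\<phi>s ! j) (D j)) \<le> l"
      unfolding assms(7) D_def using that by (intro Max_ge) auto
    then show "width (\<phi>s ! j) 0 \<le> l" "width (\<phi>s ! j) (D j) \<le> l"
      by auto
  qed
  have l: "l \<ge> 1"
    using pos[of 0 0] wl[of 0] assms(4) by linarith
  have ext_sk: "extend I \<phi>s j \<in> skeletons" and ext_depth: "depth (extend I \<phi>s j) = T n"
    and ext_width: "\<And>k. k \<le> T n \<Longrightarrow> width (extend I \<phi>s j) k
      \<le> width I 1 * width (\<phi>s ! j) (min (k - T j) (D j))" if "j < n" for j
    using extend_properties[OF I, of j \<phi>s] that sk assms(5) by (auto simp: T_def D_def)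
  have "D 0 \<ge> 1" "T n \<ge> D 0"
    using sk[of 0] assms(4) member_le_sum[of 0 "{..<n}" D] by (auto simp: skeletons_iff D_def T_def)
  then have Tn: "T n \<ge> 1"
    by simp
  have hd: "hd (map (extend I \<phi>s) [0..<length \<phi>s]) = extend I \<phi>s 0"
    using assms(4,5) by (simp add: hd_map)
  have dp: "depth ?p = T n"
    using ext_depth[of 0] assms(4) by (simp add: diag_parallelize_def depth_parallelize hd)
  have wp: "width ?p k = w k" if "k \<le> T n" for k
  proof -
    have "width ?p k = (\<Sum>\<psi>\<leftarrow>map (extend I \<phi>s) [0..<length \<phi>s]. width \<psi> k)"
      unfolding diag_parallelize_def
      using that Tn ext_depth[of 0] assms(4) hd by (intro width_parallelize) auto
    then show ?thesis
      by (simp add: w_def o_def assms(5) interv_sum_list_conv_sum_set_nat atLeast0LessThan)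
  qed
  have in_sk: "?p \<in> skeletons"
    unfolding diag_parallelize_def
    using assms(4,5) ext_sk ext_depth by (intro parallelize_in_skeletons[where d = "T n"]) auto
  have P: "num_params ?p = (\<Sum>k=1..T n. w k * (w (k - 1) + 1))"
    unfolding num_params_def dp by (intro sum.cong) (auto simp: wp)
  have "real (num_params ?p) \<le> ?K * (\<Sum>j<n. real (num_params (\<phi>s ! j)))"
  \<comment> \<open>For \<open>n = 1\<close> the quantity \<open>M\<close> is 0 and
    \<open>c \<le> M\<close> fails. But then nothing is padded, the parameter count is that of the
    only skeleton, and \<open>?K\<close> is at least \<open>11/16 * 4 - 1\<close>, which exceeds
    1.\<close>
  proof (cases "n = 1")
    case True
    moreover have "{0<..<Suc 0} = {}"
      by auto
    ultimately have "extend I \<phi>s 0 = \<phi>s ! 0"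
      using assms(5) by (simp add: extend_def Let_def)
    then have "num_params ?p = num_params (\<phi>s ! 0)"
      unfolding P using True by (simp add: w_def num_params_def T_def D_def)
    moreover have "4 \<le> c\<^sup>2" "1 \<le> (real l)\<^sup>2"
      using power_mono[OF assms(2), of 2] l by auto
    then have "4 * 1 \<le> c\<^sup>2 * (real l)\<^sup>2"
      by (intro mult_mono) auto
    then have "1 \<le> ?K"
      using True by simp
    then have "1 * real (num_params (\<phi>s ! 0)) \<le> ?K * real (num_params (\<phi>s ! 0))"
      by (intro mult_right_mono) auto
    ultimately show ?thesis
      using True by simp
  next
    case False
    with assms(4) have n: "real n \<ge> 2"
      by simp
    define M where "M = c * real l * (real n - 1)"
    \<comment> \<open>The boundary \<open>r = 0\<close> is included, so that the same bound serves
      the output and the input level of every layer in the block.\<close>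
    have level: "real (w (T i + r)) \<le> c * real (width (\<phi>s ! i) r) + M"
      if i: "i < n" and r: "r \<le> D i" for i r
    proof -
      have before: "T j + D j \<le> T i" if "j < i" for j i
      proof -
        have "T (Suc j) \<le> T i"
          unfolding T_def using that by (intro sum_mono2) auto
        then show ?thesis by (simp add: T_def)
      qed
      have "T (Suc i) \<le> T n"
        unfolding T_def using i by (intro sum_mono2) auto
      then have kT: "T i + r \<le> T n"
        using r by (simp add: T_def)
      \<comment> \<open>Used with \<open>x = l\<close> for the padded skeletons and with the actual
        width for the skeleton \<open>i\<close> itself.\<close>
      have scale: "real (width (extend I \<phi>s j) (T i + r)) \<le> c * real x"
        if "j < n" "width (\<phi>s ! j) (min (T i + r - T j) (D j)) \<le> x" for j x
      proof -
        have "width (extend I \<phi>s j) (T i + r) \<le> width I 1 * x"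
          using ext_width[OF that(1) kT] mult_le_mono2[OF that(2), of "width I 1"] by linarith
        then have "real (width (extend I \<phi>s j) (T i + r)) \<le> real (width I 1) * real x"
          by (metis of_nat_le_iff of_nat_mult)
        also have "\<dots> \<le> c * real x"
          using mc by (intro mult_right_mono) auto
        finally show ?thesis .
      qed
      have "real (width (extend I \<phi>s j) (T i + r)) \<le> c * real l" if j: "j \<in> {..<n} - {i}" for j
      proof (rule scale)
        show "j < n" using j by simp
        \<comment> \<open>In block \<open>i\<close> a skeleton with \<open>j < i\<close> is already
          past its output and one with \<open>j > i\<close> is still at its input, so only widths
          bounded by \<open>l\<close> occur.\<close>
        have "min (T i + r - T j) (D j) \<in> {0, D j}"
        proof (cases "j < i")
          case True
          then show ?thesis using before[of j i] by auto
        next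
          case False
          then have "T i + D i \<le> T j"
            using before[of i j] j by auto
          then show ?thesis using r by auto
        qed
        then show "width (\<phi>s ! j) (min (T i + r - T j) (D j)) \<le> l"
          using wl[of j] j by auto
      qed
      then have "(\<Sum>j\<in>{..<n} - {i}. real (width (extend I \<phi>s j) (T i + r)))
          \<le> real (card ({..<n} - {i})) * (c * real l)"
        by (rule sum_bounded_above)
      also have "\<dots> = M"
        using i by (simp add: M_def of_nat_diff)
      finally have "(\<Sum>j\<in>{..<n} - {i}. real (width (extend I \<phi>s j) (T i + r))) \<le> M" .
      moreover have "real (width (extend I \<phi>s i) (T i + r)) \<le> c * real (width (\<phi>s ! i) r)"
        using i r by (intro scale) auto
      moreover have "real (w (T i + r)) = real (width (extend I \<phi>s i) (T i + r))
          + (\<Sum>j\<in>{..<n} - {i}. real (width (extend I \<phi>s j) (T i + r)))"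
        unfolding w_def of_nat_sum using i by (intro sum.remove) auto
      ultimately show ?thesis
        by linarith
    qed
    have layer: "real (w (T i + r) * (w (T i + r - 1) + 1))
        \<le> ?K * real (width (\<phi>s ! i) r * (width (\<phi>s ! i) (r - 1) + 1))"
      if i: "i < n" and r: "r \<in> {1..D i}" for i r
    proof -
      let ?u = "real (width (\<phi>s ! i) r)" and ?v = "real (width (\<phi>s ! i) (r - 1))"
      have uv: "?u \<ge> 1" "?v \<ge> 1"
        using pos[OF i, of r] pos[OF i, of "r - 1"] r by auto
      \<comment> \<open>Since \<open>r \<ge> 1\<close>, the input level of the layer is again level
        \<open>r - 1\<close> of block \<open>i\<close>, possibly its boundary.\<close>
      have r': "T i + r - 1 = T i + (r - 1)" "r - 1 \<le> D i"
        using r by auto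
      have "real (w (T i + r - 1)) \<le> c * ?v + M"
        using level[OF i r'(2)] unfolding r'(1) .
      moreover have "real (w (T i + r)) \<le> c * ?u + M"
        using level[OF i, of r] r by simp
      ultimately have "real (w (T i + r)) * (real (w (T i + r - 1)) + 1)
          \<le> (c * ?u + M) * (c * ?v + M + 1)"
        by (intro mult_mono) auto
      also have "\<dots> \<le> ?K * (?u * (?v + 1))"
        unfolding M_def using assms(2) l n uv by (intro layer_bound) auto
      finally show ?thesis
        by (simp add: algebra_simps)
    qed
    have "real (num_params ?p) = (\<Sum>i<n. \<Sum>r=1..D i. real (w (T i + r) * (w (T i + r - 1) + 1)))"
      unfolding P T_def of_nat_sum by (rule sum_blocks)
    also have "\<dots> \<le> (\<Sum>i<n. \<Sum>r=1..D i. ?K * real (width (\<phi>s ! i) r * (width (\<phi>s ! i) (r - 1) + 1)))"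
      by (intro sum_mono layer) auto
    also have "\<dots> = ?K * (\<Sum>j<n. real (num_params (\<phi>s ! j)))"
      by (simp only: num_params_def D_def of_nat_sum sum_distrib_left)
    finally show ?thesis .
  qed
  with in_sk show ?thesis
    by blast
qed

end
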